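(* Let $q$ be even and let $V$ be a $(2m+1)$-dimensional vector space over $\mathbb F_q$ with a nonsingular quadratic form $Q$. Let $W,W'$ be nondegenerate hyperplanes of $V$ (not necessarily of the same type). Then $\Omega(W)\cap\mathrm O(W')\leq\Omega(W')$, as subgroups of the isometry group of $(V,Q)$.
   Context: $Q$ nonsingular means that there is no nonzero $v$ in the radical $V^\perp$ of the associated bilinear form with $Q(v)=0$; then $V^\perp$ is $1$-dimensional. A nondegenerate hyperplane is a hyperplane $W$ with $V=W\oplus V^\perp$ (so $Q|_W$ is nondegenerate). For such $W$, $\mathrm O(W)$ (equal to $\mathrm{SO}(W)$ as $q$ is even) is identified with the group of isometries of $V$ stabilizing $W$ and acting trivially on $V^\perp$, and $\Omega(W)$ is its index-$2$ subgroup, which consists of the $g\in\mathrm O(W)$ with $\dim C_W(g)$ even. *)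

theory Defs
  imports "HOL-Analysis.Analysis"
begin

text \<open>The ambient space V is 'k^'n (a finite-dimensional vector space over the field 'k,
  with dimension CARD('n)); scalar multiplication is (*s).\<close>

text \<open>Polar (associated) bilinear form of Q.\<close>
definition polar :: "('k::field ^ 'n \<Rightarrow> 'k) \<Rightarrow> 'k ^ 'n \<Rightarrow> 'k ^ 'n \<Rightarrow> 'k" where
  "polar Q u v = Q (u + v) - Q u - Q v"

text \<open>Q is a quadratic form: homogeneous of degree 2 with bilinear polar form.\<close>
definition quadratic_form :: "('k::field ^ 'n \<Rightarrow> 'k) \<Rightarrow> bool" where
  "quadratic_form Q \<longleftrightarrow>
     (\<forall>c v. Q (c *s v) = c^2 * Q v) \<and>
     (\<forall>v. Vector_Spaces.linear (*s) (*) (\<lambda>u. polar Q u v)) \<and>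
     (\<forall>u. Vector_Spaces.linear (*s) (*) (\<lambda>v. polar Q u v))"

text \<open>Radical V^perp of the associated bilinear form.\<close>
definition radical :: "('k::field ^ 'n \<Rightarrow> 'k) \<Rightarrow> ('k ^ 'n) set" where
  "radical Q = {v. \<forall>u. polar Q v u = 0}"

text \<open>Nonsingular: no nonzero singular vector in the radical.\<close>
definition nonsingular :: "('k::field ^ 'n \<Rightarrow> 'k) \<Rightarrow> bool" where
  "nonsingular Q \<longleftrightarrow> quadratic_form Q \<and> (\<forall>v \<in> radical Q. Q v = 0 \<longrightarrow> v = 0)"

text \<open>Nondegenerate hyperplane: a hyperplane W with V = W \<oplus> V^perp.\<close>
definition nondeg_hyperplane :: "('k::field ^ 'n \<Rightarrow> 'k) \<Rightarrow> ('k ^ 'n) set \<Rightarrow> bool" where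
  "nondeg_hyperplane Q W \<longleftrightarrow>
     vec.subspace W \<and> vec.dim W + 1 = CARD('n) \<and>
     W \<inter> radical Q = {0} \<and>
     {w + r | w r. w \<in> W \<and> r \<in> radical Q} = UNIV"

text \<open>Isometries of (V,Q): invertible linear maps preserving Q.\<close>
definition isometry :: "('k::field ^ 'n \<Rightarrow> 'k) \<Rightarrow> ('k ^ 'n \<Rightarrow> 'k ^ 'n) \<Rightarrow> bool" where
  "isometry Q g \<longleftrightarrow> Vector_Spaces.linear (*s) (*s) g \<and> bij g \<and> (\<forall>v. Q (g v) = Q v)"

text \<open>O(W), as the group of isometries of V stabilizing W and acting trivially on V^perp.\<close>
definition orth_group :: "('k::field ^ 'n \<Rightarrow> 'k) \<Rightarrow> ('k ^ 'n) set \<Rightarrow> ('k ^ 'n \<Rightarrow> 'k ^ 'n) set" where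
  "orth_group Q W = {g. isometry Q g \<and> g ` W = W \<and> (\<forall>r \<in> radical Q. g r = r)}"

text \<open>Omega(W): elements g of O(W) with dim C_W(g) even.\<close>
definition Omega_group :: "('k::field ^ 'n \<Rightarrow> 'k) \<Rightarrow> ('k ^ 'n) set \<Rightarrow> ('k ^ 'n \<Rightarrow> 'k ^ 'n) set" where
  "Omega_group Q W = {g \<in> orth_group Q W. even (vec.dim {w \<in> W. g w = w})}"

end

theory Submission
  imports Defs
begin

text \<open>
  Write \<open>R\<close> for the radical of \<open>Q\<close>. For \<open>g \<in> O(W)\<close> every fixed vector \<open>w + r\<close>
  (\<open>w \<in> W\<close>, \<open>r \<in> R\<close>) of \<open>g\<close> has \<open>g w = w\<close>, because \<open>g\<close> fixes \<open>R\<close> pointwise; so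
  \<open>C\<^sub>V(g) = C\<^sub>W(g) \<oplus> R\<close> and \<open>dim C\<^sub>W(g) = dim C\<^sub>V(g) - dim R\<close>. The right-hand side does not
  depend on the hyperplane, so the parity condition defining \<open>\<Omega>(W)\<close> and \<open>\<Omega>(W')\<close> agrees
  on \<open>O(W) \<inter> O(W')\<close>.
\<close>

lemma subspace_radical:
  assumes "quadratic_form Q"
  shows "vec.subspace (radical Q)"
proof -
  have hom: "module_hom (*s) (*) (\<lambda>v. polar Q v u)" for u
    using assms unfolding quadratic_form_def linear_iff_module_hom by blast
  show ?thesis
    unfolding vec.subspace_def radical_def
    by (simp add: module_hom.zero[OF hom] module_hom.add[OF hom] module_hom.scale[OF hom])
qed

lemma subspace_fixed_points:
  assumes "Vector_Spaces.linear (*s) (*s) g" and "vec.subspace W"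
  shows "vec.subspace {w \<in> W. g w = w}"
proof -
  interpret g: Vector_Spaces.linear "(*s)" "(*s)" g by fact
  show ?thesis
    using assms(2) unfolding vec.subspace_def by (auto simp: g.add g.scale)
qed

lemma dim_fixed_points_direct_sum:
  fixes g :: "'k::field ^ 'n \<Rightarrow> 'k ^ 'n"
  assumes g: "Vector_Spaces.linear (*s) (*s) g" and fix_R: "\<forall>r \<in> R. g r = r"
    and W: "vec.subspace W" and R: "vec.subspace R"
    and WR: "W \<inter> R = {0}" and sum: "{w + r | w r. w \<in> W \<and> r \<in> R} = UNIV"
  shows "vec.dim {w \<in> W. g w = w} + vec.dim R = vec.dim {v. g v = v}"
proof -
  interpret g: Vector_Spaces.linear "(*s)" "(*s)" g by fact
  let ?C = "{w \<in> W. g w = w}"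
  have C: "vec.subspace ?C"
    by (rule subspace_fixed_points[OF g W])
  have "{w + r | w r. w \<in> ?C \<and> r \<in> R} = {v. g v = v}"
  proof (intro set_eqI iffI)
    fix v assume "v \<in> {w + r | w r. w \<in> ?C \<and> r \<in> R}"
    then show "v \<in> {v. g v = v}"
      using fix_R by (auto simp: g.add)
  next
    fix v assume v: "v \<in> {v. g v = v}"
    obtain w r where wr: "v = w + r" "w \<in> W" "r \<in> R"
      using sum by blast
    then have "g w + r = w + r"
      using v fix_R by (simp add: g.add)
    then show "v \<in> {w + r | w r. w \<in> ?C \<and> r \<in> R}"
      using wr by auto
  qed
  moreover have "?C \<inter> R = {0}"
    using WR C vec.subspace_0 by auto
  ultimately show ?thesis
    using vec.dim_sums_Int[OF C R] by simp
qed

lemma dim_fixed_points_orth_group: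
  assumes "quadratic_form Q" and "nondeg_hyperplane Q W" and "g \<in> orth_group Q W"
  shows "vec.dim {w \<in> W. g w = w} + vec.dim (radical Q) = vec.dim {v. g v = v}"
  using assms subspace_radical[OF assms(1)]
  by (intro dim_fixed_points_direct_sum)
     (auto simp: nondeg_hyperplane_def orth_group_def isometry_def)

theorem mainTheorem14:
  fixes Q :: "'k::{field,finite} ^ 'n \<Rightarrow> 'k" and W W' :: "('k ^ 'n) set" and m :: nat
  assumes "even CARD('k)"
    and "CARD('n) = 2 * m + 1"
    and "nonsingular Q"
    and "nondeg_hyperplane Q W"
    and "nondeg_hyperplane Q W'"
  shows "Omega_group Q W \<inter> orth_group Q W' \<subseteq> Omega_group Q W'"
proof
  fix g assume "g \<in> Omega_group Q W \<inter> orth_group Q W'"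
  then have "g \<in> orth_group Q W" and g_W': "g \<in> orth_group Q W'"
    and even_W: "even (vec.dim {w \<in> W. g w = w})"
    unfolding Omega_group_def by auto
  have Q: "quadratic_form Q"
    using \<open>nonsingular Q\<close> unfolding nonsingular_def by blast
  have "vec.dim {w \<in> W'. g w = w} + vec.dim (radical Q) = vec.dim {v. g v = v}"
    by (rule dim_fixed_points_orth_group[OF Q assms(5) g_W'])
  also have "\<dots> = vec.dim {w \<in> W. g w = w} + vec.dim (radical Q)"
    by (rule dim_fixed_points_orth_group[OF Q assms(4) \<open>g \<in> orth_group Q W\<close>, symmetric])
  finally have "vec.dim {w \<in> W'. g w = w} = vec.dim {w \<in> W. g w = w}"
    by simp
  with even_W g_W' show "g \<in> Omega_group Q W'"
    unfolding Omega_group_def by simp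
qed

end
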